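(* In the isoperimetric control setting of the context, let $V(B)=\sup\{J(u):u\in\mathcal U,\ \mathcal C(u)=B\}$ for $B\in\mathbb R$ (with $V(B)=-\infty$ for $B\notin\operatorname{dom}V:=\{\mathcal C(u):u\in\mathcal U\}$), let $\ell(\mu)=\sup_{u\in\mathcal U}\{J(u)+\mu\,\mathcal C(u)\}$, and let $\mathcal D(B)=\operatorname{arg\,min}_{\mu\in\mathbb R}\{\ell(\mu)-\mu B\}$. Assume that $V$ is proper, concave, upper semicontinuous, and finite on $\operatorname{int}(\operatorname{dom}V)$, that $V(B)=\inf_{\mu\in\mathbb R}\{\ell(\mu)-\mu B\}$ holds, and that the infimum is attained at every $B\in\operatorname{int}(\operatorname{dom}V)$. Let $B\in\operatorname{int}(\operatorname{dom}V)$ and $\mu^*\in\mathcal D(B)$. Then $-\mu^*\in\partial^+V(B)$; equivalently, $$V(\widetilde B)-V(B)\le-\mu^*(\widetilde B-B)\qquad\text{for all }\widetilde B\in\operatorname{dom}V.$$ If $V$ is differentiable at $B$, then $V'(B)=-\mu^*$.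
   Context: Superdifferential. For concave $V$ and $B\in\operatorname{int}(\operatorname{dom}V)$, $\partial^+V(B):=\{p\in\mathbb R: V(\widetilde B)-V(B)\le p(\widetilde B-B)\text{ for all }\widetilde B\in\operatorname{dom}V\}$. "Proper" for the concave function $V$ means $V<+\infty$ everywhere and $V>-\infty$ somewhere. Setting. Fix $T>0$, $x_0\in\mathbb R^n$, $U\subset\mathbb R^m$, and $\mathcal U=\{u\in L^\infty(0,T;\mathbb R^m):u(t)\in U\text{ for a.e. }t\}$. The data $g:[0,T]\times\mathbb R^n\times\mathbb R^m\to\mathbb R^n$ and $f,h:[0,T]\times\mathbb R^n\times\mathbb R^m\to\mathbb R$ are measurable in $t$ and $C^1$ in $(x,u)$ for a.e. $t$; $g$ is Lipschitz in $x$ with a constant $L$ uniform in $u\in U$ and a.e. $t$; for some $c>0$, $\|g(t,x,u)\|\le c(1+\|x\|+\|u\|)$ and $|f(t,x,u)|,|h(t,x,u)|\le c(1+\|x\|^2+\|u\|^2)$ on $[0,T]\times\mathbb R^n\times U$; $\phi\in C^1(\mathbb R^n)$ with $|\phi(x)|\le c(1+\|x\|^2)$. For $u\in\mathcal U$, $x_u$ is the unique solution of $\dot x=g(t,x,u(t))$, $x(0)=x_0$; $J(u)=\int_0^Tf(t,x_u,u)\,dt+\phi(x_u(T))$ and $\mathcal C(u)=\int_0^Th(t,x_u,u)\,dt$ (both real-valued on $\mathcal U$). *)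

theory Defs
  imports "HOL-Analysis.Analysis"
begin

definition C1_map :: "('a::real_normed_vector \<Rightarrow> 'b::real_normed_vector) \<Rightarrow> bool" where
  "C1_map F \<longleftrightarrow>
     (\<exists>F' :: 'a \<Rightarrow> 'a \<Rightarrow>\<^sub>L 'b.
        (\<forall>z. (F has_derivative blinfun_apply (F' z)) (at z)) \<and> continuous_on UNIV F')"

text \<open>Absolute continuity of a function on a real interval; the library constant
  \<open>absolutely_continuous\<close> is the notion for measures.\<close>

definition abs_continuous_on :: "real set \<Rightarrow> (real \<Rightarrow> 'a::real_normed_vector) \<Rightarrow> bool" where
  "abs_continuous_on S x \<longleftrightarrow>
     (\<forall>e>0. \<exists>d>0. \<forall>(k::nat) a b.
        (\<forall>i<k. a i \<in> S \<and> b i \<in> S \<and> a i \<le> b i) \<longrightarrow>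
        disjoint_family_on (\<lambda>i. {a i<..<b i}) {..<k} \<longrightarrow>
        (\<Sum>i<k. b i - a i) < d \<longrightarrow> (\<Sum>i<k. norm (x (b i) - x (a i))) < e)"

definition control_data ::
  "real \<Rightarrow> (real ^ 'm) set \<Rightarrow> (real \<Rightarrow> real ^ 'n \<Rightarrow> real ^ 'm \<Rightarrow> real ^ 'n) \<Rightarrow>
   (real \<Rightarrow> real ^ 'n \<Rightarrow> real ^ 'm \<Rightarrow> real) \<Rightarrow> (real \<Rightarrow> real ^ 'n \<Rightarrow> real ^ 'm \<Rightarrow> real) \<Rightarrow>
   (real ^ 'n \<Rightarrow> real) \<Rightarrow> bool" where
  "control_data T U g f h \<phi> \<longleftrightarrow>
     T > 0 \<and>
     (\<forall>x u. (\<lambda>t. g t x u) \<in> borel_measurable (lebesgue_on {0..T}) \<and>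
            (\<lambda>t. f t x u) \<in> borel_measurable (lebesgue_on {0..T}) \<and>
            (\<lambda>t. h t x u) \<in> borel_measurable (lebesgue_on {0..T})) \<and>
     (AE t in lebesgue_on {0..T}.
        C1_map (\<lambda>(x, u). g t x u) \<and> C1_map (\<lambda>(x, u). f t x u) \<and> C1_map (\<lambda>(x, u). h t x u)) \<and>
     C1_map \<phi> \<and>
     (\<exists>L. AE t in lebesgue_on {0..T}. \<forall>u\<in>U. L-lipschitz_on UNIV (\<lambda>x. g t x u)) \<and>
     (\<exists>c>0.
        (\<forall>t\<in>{0..T}. \<forall>x. \<forall>u\<in>U.
           norm (g t x u) \<le> c * (1 + norm x + norm u) \<and>
           \<bar>f t x u\<bar> \<le> c * (1 + (norm x)\<^sup>2 + (norm u)\<^sup>2) \<and>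
           \<bar>h t x u\<bar> \<le> c * (1 + (norm x)\<^sup>2 + (norm u)\<^sup>2)) \<and>
        (\<forall>x. \<bar>\<phi> x\<bar> \<le> c * (1 + (norm x)\<^sup>2)))"

text \<open>Controls are functions, not classes modulo null sets, and their values outside
  \<open>[0,T]\<close> are irrelevant; trajectories and costs only depend on the class on \<open>[0,T]\<close>.\<close>

definition controls :: "real \<Rightarrow> (real ^ 'm) set \<Rightarrow> (real \<Rightarrow> real ^ 'm) set" where
  "controls T U =
     {u. u \<in> borel_measurable (lebesgue_on {0..T}) \<and>
         (\<exists>M. AE t in lebesgue_on {0..T}. norm (u t) \<le> M) \<and>
         (AE t in lebesgue_on {0..T}. u t \<in> U)}"

definition is_trajectory ::
  "real \<Rightarrow> (real \<Rightarrow> real ^ 'n \<Rightarrow> real ^ 'm \<Rightarrow> real ^ 'n) \<Rightarrow> real ^ 'n \<Rightarrow>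
   (real \<Rightarrow> real ^ 'm) \<Rightarrow> (real \<Rightarrow> real ^ 'n) \<Rightarrow> bool" where
  "is_trajectory T g x\<^sub>0 u x \<longleftrightarrow>
     abs_continuous_on {0..T} x \<and> x 0 = x\<^sub>0 \<and>
     (AE t in lebesgue_on {0..T}.
        (x has_vector_derivative g t (x t) (u t)) (at t within {0..T}))"

text \<open>A trajectory is only determined on \<open>[0,T]\<close>; \<^const>\<open>extensional\<close> fixes a dummy value
  elsewhere so that the description is unique.\<close>

definition trajectory ::
  "real \<Rightarrow> (real \<Rightarrow> real ^ 'n \<Rightarrow> real ^ 'm \<Rightarrow> real ^ 'n) \<Rightarrow> real ^ 'n \<Rightarrow>
   (real \<Rightarrow> real ^ 'm) \<Rightarrow> (real \<Rightarrow> real ^ 'n)" where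
  "trajectory T g x\<^sub>0 u = (THE x. x \<in> extensional {0..T} \<and> is_trajectory T g x\<^sub>0 u x)"

definition running_cost ::
  "real \<Rightarrow> (real \<Rightarrow> real ^ 'n \<Rightarrow> real ^ 'm \<Rightarrow> real ^ 'n) \<Rightarrow> real ^ 'n \<Rightarrow>
   (real \<Rightarrow> real ^ 'n \<Rightarrow> real ^ 'm \<Rightarrow> real) \<Rightarrow> (real \<Rightarrow> real ^ 'm) \<Rightarrow> real" where
  "running_cost T g x\<^sub>0 k u = (LINT t|lebesgue_on {0..T}. k t (trajectory T g x\<^sub>0 u t) (u t))"

definition objective ::
  "real \<Rightarrow> (real \<Rightarrow> real ^ 'n \<Rightarrow> real ^ 'm \<Rightarrow> real ^ 'n) \<Rightarrow> real ^ 'n \<Rightarrow>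
   (real \<Rightarrow> real ^ 'n \<Rightarrow> real ^ 'm \<Rightarrow> real) \<Rightarrow> (real ^ 'n \<Rightarrow> real) \<Rightarrow> (real \<Rightarrow> real ^ 'm) \<Rightarrow> real" where
  "objective T g x\<^sub>0 f \<phi> u = running_cost T g x\<^sub>0 f u + \<phi> (trajectory T g x\<^sub>0 u T)"

text \<open>The supremum of the empty set is \<open>-\<infinity>\<close>, so the value is \<open>-\<infinity>\<close> exactly off \<open>C ` A\<close>.\<close>

definition value_function :: "'u set \<Rightarrow> ('u \<Rightarrow> real) \<Rightarrow> ('u \<Rightarrow> real) \<Rightarrow> real \<Rightarrow> ereal" where
  "value_function A J C B = (SUP u\<in>{u \<in> A. C u = B}. ereal (J u))"

definition dual_function :: "'u set \<Rightarrow> ('u \<Rightarrow> real) \<Rightarrow> ('u \<Rightarrow> real) \<Rightarrow> real \<Rightarrow> ereal" where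
  "dual_function A J C \<mu> = (SUP u\<in>A. ereal (J u + \<mu> * C u))"

definition dual_minimizers :: "(real \<Rightarrow> ereal) \<Rightarrow> real \<Rightarrow> real set" where
  "dual_minimizers l B = {\<mu>. is_arg_min (\<lambda>\<mu>. l \<mu> - ereal (\<mu> * B)) (\<lambda>_. True) \<mu>}"

definition ereal_concave :: "(real \<Rightarrow> ereal) \<Rightarrow> bool" where
  "ereal_concave V \<longleftrightarrow> convex {(B, r). ereal r \<le> V B}"

definition ereal_proper_concave :: "(real \<Rightarrow> ereal) \<Rightarrow> bool" where
  "ereal_proper_concave V \<longleftrightarrow> ereal_concave V \<and> (\<forall>B. V B < \<infinity>) \<and> (\<exists>B. V B > -\<infinity>)"

definition upper_semicontinuous :: "(real \<Rightarrow> ereal) \<Rightarrow> bool" where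
  "upper_semicontinuous V \<longleftrightarrow> (\<forall>B. Limsup (at B) V \<le> V B)"

definition superdifferential :: "real set \<Rightarrow> (real \<Rightarrow> ereal) \<Rightarrow> real \<Rightarrow> real set" where
  "superdifferential D V B = {p. \<forall>B'\<in>D. V B' - V B \<le> ereal (p * (B' - B))}"

end

theory Submission
  imports Defs
begin

text \<open>By duality, \<open>V\<close> is the pointwise infimum of the functions
  \<open>l \<nu> - \<nu> * b\<close> of \<open>b\<close>, so each of them lies above
  \<open>V\<close>. When \<mu> is a dual minimizer at \<open>B\<close>, its function also touches
  \<open>V\<close> at \<open>B\<close>; since \<open>V B\<close> is finite, \<open>l \<mu>\<close>
  is finite, and the function is a supporting line of slope \<open>- \<mu>\<close>. That is
  \<open>dual_minimizer_in_superdifferential\<close>. If \<open>V\<close> is differentiable at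
  \<open>B\<close>, subtracting the linear part of a supporting line leaves a function with a local
  maximum at \<open>B\<close>, so the slope must be the derivative
  (\<open>superdifferential_eq_deriv\<close>).\<close>

lemma dual_minimizer_in_superdifferential:
  assumes duality: "\<And>b. V b = (INF \<nu>. l \<nu> - ereal (\<nu> * b))"
    and fin: "\<bar>V B\<bar> \<noteq> \<infinity>"
    and \<mu>: "\<mu> \<in> dual_minimizers l B"
  shows "- \<mu> \<in> superdifferential D V B"
proof -
  have "l \<mu> - ereal (\<mu> * B) \<le> l \<nu> - ereal (\<nu> * B)" for \<nu>
    using \<mu> by (auto simp: dual_minimizers_def is_arg_min_def not_less)
  \<comment> \<open>The infimum in the duality formula at \<open>B\<close> is attained at \<mu>: the
    line touches the graph.\<close>
  then have VB: "V B = l \<mu> - ereal (\<mu> * B)"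
    unfolding duality by (intro antisym INF_lower INF_greatest) auto
  have "V b - V B \<le> ereal (- \<mu> * (b - B))" for b
  proof -
    have "V b \<le> l \<mu> - ereal (\<mu> * b)"
      unfolding duality by (rule INF_lower) simp
    \<comment> \<open>Finiteness of \<open>V B\<close> forces \<open>l \<mu>\<close> to be real, so
      it cancels in the difference. The bound then excludes \<open>V b = \<infinity>\<close>, and
      for \<open>V b = -\<infinity>\<close> the claim is trivial.\<close>
    then show ?thesis
      using fin unfolding VB
      by (cases "l \<mu>"; cases "V b") (auto simp: algebra_simps)
  qed
  then show ?thesis
    by (simp add: superdifferential_def)
qed

text \<open>Fermat's rule: a supergradient \<open>p\<close> makes \<open>B\<close> a maximizer of
  \<open>V b - p * b\<close> near \<open>B\<close>, where the derivative has to vanish.\<close>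

lemma superdifferential_eq_deriv:
  assumes p: "p \<in> superdifferential D V B"
    and fin: "\<forall>b \<in> interior D. \<bar>V b\<bar> \<noteq> \<infinity>"
    and B: "B \<in> interior D"
    and diff: "(\<lambda>b. real_of_ereal (V b)) differentiable (at B)"
  shows "deriv (\<lambda>b. real_of_ereal (V b)) B = p"
proof -
  let ?v = "\<lambda>b. real_of_ereal (V b)"
  obtain v' where v': "(?v has_field_derivative v') (at B)"
    using diff by (auto simp: real_differentiable_def)
  \<comment> \<open>Inside this ball \<open>V\<close> is finite, so \<open>real_of_ereal\<close>
    returns its true value and not the default 0 that it gives at infinite values. The supergradient
    inequality therefore passes to the reals.\<close>
  obtain d where d: "d > 0" "ball B d \<subseteq> interior D"
    using B open_contains_ball[of "interior D"] by auto
  have "?v b - p * b \<le> ?v B - p * B" if "\<bar>B - b\<bar> < d" for b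
  proof -
    have b: "b \<in> interior D"
      using d that by (auto simp: dist_real_def subset_iff)
    then have "V b - V B \<le> ereal (p * (b - B))"
      using p interior_subset by (auto simp: superdifferential_def)
    then show ?thesis
      using fin b B by (cases "V b"; cases "V B") (auto simp: algebra_simps)
  qed
  moreover have "((\<lambda>b. ?v b - p * b) has_field_derivative v' - p) (at B)"
    using v' by (auto intro!: derivative_eq_intros)
  ultimately have "v' - p = 0"
    using DERIV_local_max[of "\<lambda>b. ?v b - p * b" "v' - p" B d] d(1) by blast
  then show ?thesis
    using DERIV_imp_deriv[OF v'] by simp
qed

theorem corollary3p10:
  fixes T :: real and x\<^sub>0 :: "real ^ 'n" and U :: "(real ^ 'm) set"
    and g :: "real \<Rightarrow> real ^ 'n \<Rightarrow> real ^ 'm \<Rightarrow> real ^ 'n"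
    and f h :: "real \<Rightarrow> real ^ 'n \<Rightarrow> real ^ 'm \<Rightarrow> real"
    and \<phi> :: "real ^ 'n \<Rightarrow> real"
    and \<U> :: "(real \<Rightarrow> real ^ 'm) set" and J C :: "(real \<Rightarrow> real ^ 'm) \<Rightarrow> real"
    and V l :: "real \<Rightarrow> ereal" and domV :: "real set"
    and B \<mu> :: real
  assumes data: "control_data T U g f h \<phi>"
    and \<U>: "\<U> = controls T U"
    and J: "J = objective T g x\<^sub>0 f \<phi>"
    and C: "C = running_cost T g x\<^sub>0 h"
    and V: "V = value_function \<U> J C"
    and domV: "domV = C ` \<U>"
    and l: "l = dual_function \<U> J C"
    and proper_concave: "ereal_proper_concave V"
    and usc: "upper_semicontinuous V"
    and finite_V: "\<forall>b \<in> interior domV. \<bar>V b\<bar> \<noteq> \<infinity>"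
    and strong_duality: "\<forall>b. V b = (INF \<nu>. l \<nu> - ereal (\<nu> * b))"
    and attained: "\<forall>b \<in> interior domV. \<exists>\<nu>. l \<nu> - ereal (\<nu> * b) = (INF \<nu>. l \<nu> - ereal (\<nu> * b))"
    and B: "B \<in> interior domV"
    and \<mu>: "\<mu> \<in> dual_minimizers l B"
  shows "- \<mu> \<in> superdifferential domV V B \<and>
    (\<forall>B' \<in> domV. V B' - V B \<le> ereal (- \<mu> * (B' - B))) \<and>
    ((\<lambda>b. real_of_ereal (V b)) differentiable (at B) \<longrightarrow>
      deriv (\<lambda>b. real_of_ereal (V b)) B = - \<mu>)"
proof -
  have "\<bar>V B\<bar> \<noteq> \<infinity>"
    using finite_V B by (rule bspec)
  then have "- \<mu> \<in> superdifferential domV V B"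
    by (rule dual_minimizer_in_superdifferential[OF strong_duality[rule_format] _ \<mu>])
  \<comment> \<open>The inequality on \<open>domV\<close> is the membership unfolded; the derivative
    claim is Fermat's rule with \<open>p = - \<mu>\<close>.\<close>
  then show ?thesis
    using superdifferential_eq_deriv[OF _ finite_V B]
    by (auto simp: superdifferential_def)
qed

end
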